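(* Let $\pi$ be a permutation that has opposing adjacencies, i.e. $\pi$ contains at least one up-adjacency and at least one down-adjacency. Then $\mu[1,\pi]=0$.
   Context: Permutations are ordered by containment: $\sigma\le\pi$ if $\pi$ has a subsequence order-isomorphic to $\sigma$. For permutations $\sigma,\pi$, $[\sigma,\pi]=\{\tau:\sigma\le\tau\le\pi\}$ and $[\sigma,\pi)=\{\tau:\sigma\le\tau<\pi\}$. The Möbius function is defined by $\mu[\sigma,\pi]=0$ if $\sigma\not\le\pi$, $\mu[\sigma,\pi]=1$ if $\sigma=\pi$, and $\mu[\sigma,\pi]=-\sum_{\tau\in[\sigma,\pi)}\mu[\sigma,\tau]$ otherwise; $1$ denotes the permutation of length one. An interval of a permutation $\pi=\pi_1\cdots\pi_n$ is a non-empty set of contiguous positions $i,i+1,\dots,j$ such that the set of values $\{\pi_i,\dots,\pi_j\}$ is also a set of consecutive integers. An adjacency is an interval of length two; it is an up-adjacency if $\pi_{i}<\pi_{i+1}$ and a down-adjacency otherwise. *)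

theory Defs
  imports "HOL-Combinatorics.Multiset_Permutations" "HOL-Library.Sublist"
begin

text \<open>A permutation of length \<open>n\<close> is given in one-line notation, as a list containing each of
  the values \<open>1, \<dots>, n\<close> exactly once.  Positions are counted from \<open>0\<close>, as usual for lists.\<close>

definition is_perm :: "nat list \<Rightarrow> bool" where
  "is_perm xs \<longleftrightarrow> xs \<in> permutations_of_set {1..length xs}"

definition order_isomorphic :: "nat list \<Rightarrow> nat list \<Rightarrow> bool" where
  "order_isomorphic xs ys \<longleftrightarrow>
     length xs = length ys \<and>
     (\<forall>i<length xs. \<forall>j<length xs. xs ! i < xs ! j \<longleftrightarrow> ys ! i < ys ! j)"

definition contained_in :: "nat list \<Rightarrow> nat list \<Rightarrow> bool" where
  "contained_in \<sigma> \<pi> \<longleftrightarrow> (\<exists>xs. subseq xs \<pi> \<and> order_isomorphic xs \<sigma>)"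

definition perm_Icc :: "nat list \<Rightarrow> nat list \<Rightarrow> nat list set" where
  "perm_Icc \<sigma> \<pi> = {\<tau>. is_perm \<tau> \<and> contained_in \<sigma> \<tau> \<and> contained_in \<tau> \<pi>}"

definition perm_Ico :: "nat list \<Rightarrow> nat list \<Rightarrow> nat list set" where
  "perm_Ico \<sigma> \<pi> = {\<tau> \<in> perm_Icc \<sigma> \<pi>. \<tau> \<noteq> \<pi>}"

lemma perm_nth_eq_card:
  assumes "is_perm xs" and "i < length xs"
  shows "xs ! i = Suc (card {j. j < length xs \<and> xs ! j < xs ! i})"
proof -
  from assms(1) have set: "set xs = {1..length xs}" and dist: "distinct xs"
    by (simp_all add: is_perm_def permutations_of_set_def)
  have pos: "1 \<le> xs ! i" "xs ! i \<le> length xs"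
    using nth_mem[OF assms(2)] by (simp_all add: set)
  have "(!) xs ` {j. j < length xs \<and> xs ! j < xs ! i} = {x \<in> set xs. x < xs ! i}"
    by (auto simp: in_set_conv_nth)
  also have "\<dots> = {1..<xs ! i}"
    using pos by (auto simp: set)
  finally have img: "(!) xs ` {j. j < length xs \<and> xs ! j < xs ! i} = {1..<xs ! i}" .
  have "inj_on ((!) xs) {j. j < length xs \<and> xs ! j < xs ! i}"
    using dist by (auto simp: inj_on_def nth_eq_iff_index_eq)
  from card_image[OF this] show ?thesis
    using pos by (simp add: img)
qed

lemma order_isomorphic_perm_eq:
  assumes "is_perm xs" and "is_perm ys" and "order_isomorphic xs ys"
  shows "xs = ys"
proof (rule nth_equalityI)
  show len: "length xs = length ys"
    using assms(3) by (simp add: order_isomorphic_def)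
  fix i assume i: "i < length xs"
  have "{j. j < length xs \<and> xs ! j < xs ! i} = {j. j < length ys \<and> ys ! j < ys ! i}"
    using assms(3) i by (auto simp: order_isomorphic_def)
  then show "xs ! i = ys ! i"
    using perm_nth_eq_card[OF assms(1) i] perm_nth_eq_card[OF assms(2), of i] i len by simp
qed

lemma perm_Ico_length_less:
  assumes "is_perm \<pi>" and "\<tau> \<in> perm_Ico \<sigma> \<pi>"
  shows "length \<tau> < length \<pi>"
proof -
  from assms(2) obtain xs where xs: "subseq xs \<pi>" "order_isomorphic xs \<tau>"
    and \<tau>: "is_perm \<tau>" "\<tau> \<noteq> \<pi>"
    by (auto simp: perm_Ico_def perm_Icc_def contained_in_def)
  have len: "length xs = length \<tau>"
    using xs(2) by (simp add: order_isomorphic_def)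
  have "xs \<noteq> \<pi>"
    using order_isomorphic_perm_eq[OF assms(1) \<tau>(1)] xs(2) \<tau>(2) by auto
  with xs(1) have "length xs < length \<pi>"
    using list_emb_length[OF xs(1)] subseq_same_length[OF xs(1)] by force
  with len show ?thesis by simp
qed

text \<open>Lists that are not permutations are outside the poset, and the function is \<open>0\<close> there.\<close>

function mobius :: "nat list \<Rightarrow> nat list \<Rightarrow> int" where
  "mobius \<sigma> \<pi> =
     (if \<not> (is_perm \<sigma> \<and> is_perm \<pi> \<and> contained_in \<sigma> \<pi>) then 0
      else if \<sigma> = \<pi> then 1
      else - (\<Sum>\<tau>\<in>perm_Ico \<sigma> \<pi>. mobius \<sigma> \<tau>))"
  by auto
termination
  by (relation "measure (\<lambda>(\<sigma>, \<pi>). length \<pi>)") (auto intro: perm_Ico_length_less)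

declare mobius.simps [simp del]

lemma finite_perm_Icc: "finite (perm_Icc \<sigma> \<pi>)"
proof (rule finite_subset)
  show "perm_Icc \<sigma> \<pi> \<subseteq> {xs. set xs \<subseteq> {..length \<pi>} \<and> length xs \<le> length \<pi>}"
    by (auto simp: perm_Icc_def contained_in_def order_isomorphic_def is_perm_def
        permutations_of_set_def dest!: list_emb_length)
  show "finite {xs. set xs \<subseteq> {..length \<pi>} \<and> length xs \<le> length \<pi>}"
    by (rule finite_lists_length_le) simp
qed

definition is_interval :: "nat list \<Rightarrow> nat set \<Rightarrow> bool" where
  "is_interval \<pi> I \<longleftrightarrow>
     (\<exists>i j. i \<le> j \<and> j < length \<pi> \<and> I = {i..j}) \<and> (\<exists>a b. (!) \<pi> ` I = {a..b})"

definition is_adjacency :: "nat list \<Rightarrow> nat set \<Rightarrow> bool" where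
  "is_adjacency \<pi> I \<longleftrightarrow> is_interval \<pi> I \<and> card I = 2"

definition is_up_adjacency :: "nat list \<Rightarrow> nat set \<Rightarrow> bool" where
  "is_up_adjacency \<pi> I \<longleftrightarrow> is_adjacency \<pi> I \<and> \<pi> ! Min I < \<pi> ! Max I"

definition is_down_adjacency :: "nat list \<Rightarrow> nat set \<Rightarrow> bool" where
  "is_down_adjacency \<pi> I \<longleftrightarrow> is_adjacency \<pi> I \<and> \<not> is_up_adjacency \<pi> I"

definition has_opposing_adjacencies :: "nat list \<Rightarrow> bool" where
  "has_opposing_adjacencies \<pi> \<longleftrightarrow>
     (\<exists>I. is_up_adjacency \<pi> I) \<and> (\<exists>J. is_down_adjacency \<pi> J)"

end

theory Submission
  imports Defs
begin

text \<open>By induction on the length of \<open>\<pi>\<close>, every proper pattern of \<open>\<pi>\<close> with opposing adjacencies has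
  Moebius value \<open>0\<close>. Let \<open>\<alpha>\<close> and \<open>\<beta>\<close> arise from \<open>\<pi>\<close> by deleting one entry of an up-adjacency and
  one entry of a down-adjacency, and let \<open>\<phi>\<close> arise by deleting both. A pattern of \<open>\<pi>\<close> that is in
  neither \<open>[1, \<alpha>]\<close> nor \<open>[1, \<beta>]\<close> inherits both adjacencies, and so does a pattern that is in both but
  not in \<open>[1, \<phi>]\<close>. Hence \<open>- \<mu>[1, \<pi>]\<close> is the sum of \<open>\<mu>[1, \<tau>]\<close> over \<open>[1, \<alpha>]\<close> plus that over
  \<open>[1, \<beta>]\<close> minus that over \<open>[1, \<phi>]\<close>, and all three vanish.\<close>

section \<open>Order isomorphism and pattern containment for distinct lists\<close>

lemma order_isomorphic_sym: "order_isomorphic xs ys \<Longrightarrow> order_isomorphic ys xs"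
  by (auto simp: order_isomorphic_def)

lemma order_isomorphic_trans:
  "order_isomorphic xs ys \<Longrightarrow> order_isomorphic ys zs \<Longrightarrow> order_isomorphic xs zs"
  by (auto simp: order_isomorphic_def)

lemma order_isomorphic_map:
  assumes "strict_mono_on (set xs) f"
  shows "order_isomorphic xs (map f xs)"
  using strict_mono_on_less[OF assms] by (auto simp: order_isomorphic_def)

text \<open>Distinctness lets a value determine its position, so the positionwise relation becomes a
  relabelling of values; \<open>map\<close> then carries subsequences along.\<close>

lemma order_isomorphic_imp_map:
  assumes "distinct xs" and "order_isomorphic xs ys"
  obtains f where "ys = map f xs" "strict_mono_on (set xs) f"
proof
  let ?f = "\<lambda>x. ys ! (THE i. i < length xs \<and> xs ! i = x)"
  have f: "?f (xs ! i) = ys ! i" if "i < length xs" for i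
  proof -
    have "(THE j. j < length xs \<and> xs ! j = xs ! i) = i"
      using assms(1) that by (auto simp: nth_eq_iff_index_eq)
    then show ?thesis by simp
  qed
  show "ys = map ?f xs"
    using assms(2) f by (auto intro!: nth_equalityI simp: order_isomorphic_def)
  show "strict_mono_on (set xs) ?f"
  proof (rule strict_mono_onI)
    fix r s assume "r \<in> set xs" "s \<in> set xs" "r < s"
    then obtain i j where "i < length xs" "j < length xs" "r = xs ! i" "s = xs ! j"
      by (auto simp: in_set_conv_nth)
    then show "?f r < ?f s"
      using \<open>r < s\<close> assms(2) f by (auto simp: order_isomorphic_def)
  qed
qed

lemma subseq_set_subset: "subseq xs ys \<Longrightarrow> set xs \<subseteq> set ys"
  by (auto elim: list_emb_set)

lemma is_perm_distinct: "is_perm xs \<Longrightarrow> distinct xs"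
  by (simp add: is_perm_def permutations_of_set_def)

lemma contained_in_order_isomorphic:
  assumes "distinct xs" and "order_isomorphic xs ys" and "contained_in \<tau> xs"
  shows "contained_in \<tau> ys"
proof -
  obtain f where f: "ys = map f xs" "strict_mono_on (set xs) f"
    using order_isomorphic_imp_map[OF assms(1,2)] .
  obtain zs where zs: "subseq zs xs" "order_isomorphic zs \<tau>"
    using assms(3) by (auto simp: contained_in_def)
  have "strict_mono_on (set zs) f"
    using monotone_on_subset[OF f(2)] subseq_set_subset[OF zs(1)] by blast
  from order_isomorphic_map[OF this] have "order_isomorphic (map f zs) \<tau>"
    using zs(2) order_isomorphic_sym order_isomorphic_trans by blast
  moreover have "subseq (map f zs) ys"
    using zs(1) f(1) subseq_map by blast
  ultimately show ?thesis by (auto simp: contained_in_def)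
qed

lemma contained_in_subseq: "contained_in \<tau> xs \<Longrightarrow> subseq xs ys \<Longrightarrow> contained_in \<tau> ys"
  unfolding contained_in_def by (meson subseq_order.order_trans)

lemma contained_in_length: "contained_in \<tau> xs \<Longrightarrow> length \<tau> \<le> length xs"
  by (auto simp: contained_in_def order_isomorphic_def dest: list_emb_length)

lemma contained_in_singleton: "contained_in [a] xs \<longleftrightarrow> xs \<noteq> []"
proof
  assume "xs \<noteq> []"
  then obtain x ys where "xs = x # ys" by (cases xs) auto
  then show "contained_in [a] xs"
    unfolding contained_in_def
    by (intro exI[of _ "[x]"]) (auto simp: order_isomorphic_def)
qed (use contained_in_length in force)

text \<open>Standardisation: every list of distinct numbers has the pattern of some
  permutation.\<close>

lemma perm_of_distinct:
  assumes "distinct xs"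
  obtains \<sigma> where "is_perm \<sigma>" "order_isomorphic xs \<sigma>"
proof
  \<comment> \<open>The rank of \<open>x\<close> among the entries; \<open>x\<close> itself is
    counted, so ranks start at 1.\<close>
  let ?f = "\<lambda>x. card {y \<in> set xs. y \<le> x}"
  have sm: "strict_mono_on (set xs) ?f"
  proof (rule strict_mono_onI)
    fix r s assume "r \<in> set xs" "s \<in> set xs" "r < s"
    then have "{y \<in> set xs. y \<le> r} \<subseteq> {y \<in> set xs. y \<le> s}"
      and "s \<in> {y \<in> set xs. y \<le> s} - {y \<in> set xs. y \<le> r}"
      by auto
    then have "{y \<in> set xs. y \<le> r} \<subset> {y \<in> set xs. y \<le> s}"
      by blast
    then show "?f r < ?f s"
      by (intro psubset_card_mono) auto
  qed
  then have inj: "inj_on ?f (set xs)"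
    by (rule strict_mono_on_imp_inj_on)
  have "?f ` set xs \<subseteq> {1..length xs}"
  proof
    fix k assume "k \<in> ?f ` set xs"
    then obtain x where x: "x \<in> set xs" "k = ?f x" by auto
    have "k \<le> card (set xs)"
      unfolding x by (rule card_mono) auto
    moreover have "k \<noteq> 0"
      using x by auto
    ultimately show "k \<in> {1..length xs}"
      using assms by (simp add: distinct_card)
  qed
  moreover have "card (?f ` set xs) = length xs"
    using card_image[OF inj] assms by (simp add: distinct_card)
  ultimately have "?f ` set xs = {1..length xs}"
    by (intro card_subset_eq) auto
  then show "is_perm (map ?f xs)"
    using assms inj by (auto simp: is_perm_def permutations_of_set_def distinct_map)
  show "order_isomorphic xs (map ?f xs)"
    using sm by (rule order_isomorphic_map)
qed

section \<open>Vanishing sums of the Moebius function over closed intervals\<close>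

text \<open>This is the defining recursion with the top term moved to the other side. The length
  bound excludes \<open>[1]\<close>, where the sum is 1.\<close>

lemma sum_mobius_perm:
  assumes "is_perm \<sigma>" and "2 \<le> length \<sigma>"
  shows "(\<Sum>\<tau>\<in>perm_Icc [1] \<sigma>. mobius [1] \<tau>) = 0"
proof -
  have \<sigma>: "\<sigma> \<noteq> []" "\<sigma> \<noteq> [1]" using assms(2) by auto
  have one: "is_perm [1]"
    by (simp add: is_perm_def permutations_of_set_def)
  have "contained_in \<sigma> \<sigma>"
    by (auto simp: contained_in_def order_isomorphic_def)
  then have "perm_Icc [1] \<sigma> = insert \<sigma> (perm_Ico [1] \<sigma>)"
    using assms(1) \<sigma> by (auto simp: perm_Ico_def perm_Icc_def contained_in_singleton)
  moreover have "finite (perm_Ico [1] \<sigma>)" "\<sigma> \<notin> perm_Ico [1] \<sigma>"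
    using finite_perm_Icc by (auto simp: perm_Ico_def)
  ultimately show ?thesis
    using mobius.simps[of "[1]" \<sigma>] assms(1) one \<sigma> by (simp add: contained_in_singleton)
qed

text \<open>\<open>perm_Icc [1] xs\<close> depends only on the pattern of \<open>xs\<close>, so the
  sum may be taken over the standardisation. Lists with deleted entries can thus be used without
  renumbering.\<close>

lemma sum_mobius_distinct:
  assumes "distinct xs" and "2 \<le> length xs"
  shows "(\<Sum>\<tau>\<in>perm_Icc [1] xs. mobius [1] \<tau>) = 0"
proof -
  obtain \<sigma> where \<sigma>: "is_perm \<sigma>" "order_isomorphic xs \<sigma>"
    using perm_of_distinct[OF assms(1)] .
  have "contained_in \<tau> xs \<longleftrightarrow> contained_in \<tau> \<sigma>" for \<tau>
    using \<sigma> assms(1) is_perm_distinct order_isomorphic_sym contained_in_order_isomorphic by metis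
  then have "perm_Icc [1] xs = perm_Icc [1] \<sigma>"
    by (simp add: perm_Icc_def)
  moreover have "length \<sigma> = length xs"
    using \<sigma>(2) by (simp add: order_isomorphic_def)
  ultimately show ?thesis
    using sum_mobius_perm[OF \<sigma>(1)] assms(2) by simp
qed

section \<open>Adjacencies in lists, their transport and their behaviour under deletion\<close>

text \<open>Adjacency relative to the other entries of a list, so that the notion makes sense for
  subsequences of a permutation without standardising them.\<close>

definition adjacent_in :: "nat list \<Rightarrow> nat \<Rightarrow> nat \<Rightarrow> bool" where
  "adjacent_in xs x x' \<longleftrightarrow>
     (\<exists>ps qs. xs = ps @ x # x' # qs \<and> (\<forall>z\<in>set ps \<union> set qs. z < x \<longleftrightarrow> z < x'))"

text \<open>The form by positions suits order isomorphism, which compares entries position by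
  position; the form by \<open>ps\<close> and \<open>qs\<close> suits filtering.\<close>

lemma adjacent_in_nth:
  "adjacent_in xs x x' \<longleftrightarrow> (\<exists>i. Suc i < length xs \<and> x = xs ! i \<and> x' = xs ! Suc i \<and>
     (\<forall>j<length xs. j \<noteq> i \<longrightarrow> j \<noteq> Suc i \<longrightarrow> (xs ! j < x \<longleftrightarrow> xs ! j < x')))"
  (is "_ \<longleftrightarrow> (\<exists>i. ?P i)")
proof
  assume "adjacent_in xs x x'"
  then obtain ps qs where xs: "xs = ps @ x # x' # qs"
    and z: "\<forall>z\<in>set ps \<union> set qs. z < x \<longleftrightarrow> z < x'"
    by (auto simp: adjacent_in_def)
  have "xs ! j \<in> set ps \<union> set qs"
    if "j < length xs" "j \<noteq> length ps" "j \<noteq> Suc (length ps)" for j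
  proof (cases "j < length ps")
    case False
    then have j: "j = length ps + Suc (Suc (j - length ps - 2))"
      using that by simp
    then have "j - length ps - 2 < length qs"
      using that(1) unfolding xs by simp
    moreover have "xs ! j = qs ! (j - length ps - 2)"
      by (subst j) (simp add: xs nth_append)
    ultimately show ?thesis by simp
  qed (simp add: xs nth_append)
  then have "?P (length ps)"
    using xs z by (auto simp: nth_append)
  then show "\<exists>i. ?P i" ..
next
  assume "\<exists>i. ?P i"
  then obtain i where i: "?P i" ..
  have "xs = take i xs @ x # x' # drop (Suc (Suc i)) xs"
    using i by (metis Cons_nth_drop_Suc Suc_lessD append_take_drop_id)
  moreover have "z < x \<longleftrightarrow> z < x'" if "z \<in> set (take i xs) \<union> set (drop (Suc (Suc i)) xs)" for z
  proof -
    have "\<exists>j<length xs. j \<noteq> i \<and> j \<noteq> Suc i \<and> z = xs ! j"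
      using that
    proof
      assume "z \<in> set (take i xs)"
      then obtain j where "j < i" "j < length xs" "z = xs ! j"
        by (auto simp: in_set_conv_nth)
      then show ?thesis by (intro exI[of _ j]) simp
    next
      assume "z \<in> set (drop (Suc (Suc i)) xs)"
      then obtain j where "j < length xs - Suc (Suc i)" "z = xs ! (Suc (Suc i) + j)"
        by (auto simp: in_set_conv_nth)
      then show ?thesis by (intro exI[of _ "Suc (Suc i) + j"]) simp
    qed
    then show ?thesis using i by blast
  qed
  ultimately show "adjacent_in xs x x'"
    unfolding adjacent_in_def by blast
qed

text \<open>Both comparisons are carried over, so that the image is again of the same type, up or
  down.\<close>

lemma adjacent_in_order_isomorphic:
  assumes "order_isomorphic xs ys" and "adjacent_in xs x x'"
  obtains y y' where "adjacent_in ys y y'" "y < y' \<longleftrightarrow> x < x'" "y' < y \<longleftrightarrow> x' < x"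
proof -
  from assms(2) obtain i where i: "Suc i < length xs" "x = xs ! i" "x' = xs ! Suc i"
    "\<forall>j<length xs. j \<noteq> i \<longrightarrow> j \<noteq> Suc i \<longrightarrow> (xs ! j < x \<longleftrightarrow> xs ! j < x')"
    by (auto simp: adjacent_in_nth)
  have "adjacent_in ys (ys ! i) (ys ! Suc i)"
    unfolding adjacent_in_nth
    using assms(1) i by (intro exI[of _ i]) (auto simp: order_isomorphic_def)
  then show ?thesis
    using that[of "ys ! i" "ys ! Suc i"] assms(1) i by (auto simp: order_isomorphic_def)
qed

lemma adjacent_in_filter:
  assumes "adjacent_in xs x x'" "P x" "P x'"
  shows "adjacent_in (filter P xs) x x'"
proof -
  from assms(1) obtain ps qs where "xs = ps @ x # x' # qs"
    "\<forall>z\<in>set ps \<union> set qs. z < x \<longleftrightarrow> z < x'"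
    by (auto simp: adjacent_in_def)
  then show ?thesis
    unfolding adjacent_in_def using assms(2,3)
    by (intro exI[of _ "filter P ps"] exI[of _ "filter P qs"]) auto
qed

text \<open>In a distinct list a subsequence is determined by its set of values, so it can be split
  along any decomposition of the list.\<close>

lemma subseq_distinct_filter: "subseq ys xs \<Longrightarrow> distinct xs \<Longrightarrow> ys = filter (\<lambda>x. x \<in> set ys) xs"
proof (induction rule: list_emb.induct)
  case (list_emb_Cons ys xs x)
  then have "x \<notin> set ys" using subseq_set_subset by fastforce
  then show ?case using list_emb_Cons by simp
next
  case (list_emb_Cons2 x y xs ys)
  then have "filter (\<lambda>z. z \<in> set (x # xs)) ys = filter (\<lambda>z. z \<in> set xs) ys"
    by (intro filter_cong) auto
  then show ?case using list_emb_Cons2 by simp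
qed simp

text \<open>An embedding that uses only the second entry of an adjacency can be moved to the first one,
  hence deleting the second entry only destroys embeddings which use both.\<close>

lemma subseq_adjacent_cases:
  assumes "distinct xs" "adjacent_in xs x x'" "subseq ys xs" "order_isomorphic ys \<tau>"
  shows "contained_in \<tau> (filter (\<lambda>z. z \<noteq> x') xs) \<or> adjacent_in ys x x'"
proof -
  let ?P = "\<lambda>z. z \<in> set ys"
  have ys: "ys = filter ?P xs"
    using subseq_distinct_filter[OF assms(3,1)] .
  from assms(2) obtain ps qs where xs: "xs = ps @ x # x' # qs"
    and adj: "\<forall>z\<in>set ps \<union> set qs. z < x \<longleftrightarrow> z < x'"
    by (auto simp: adjacent_in_def)
  have del: "filter (\<lambda>z. z \<noteq> x') xs = ps @ x # qs"
    using assms(1) by (auto simp: xs intro!: filter_True arg_cong2[where f = "(@)"])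
  consider (both) "?P x" "?P x'" | (first) "\<not> ?P x'" | (second) "\<not> ?P x" "?P x'" by blast
  then show ?thesis
  proof cases
    case both
    then show ?thesis using adjacent_in_filter[OF assms(2), of ?P] ys by simp
  next
    case first
    then have "ys = filter ?P (ps @ x # qs)"
      by (subst ys) (simp add: xs)
    then have "subseq ys (filter (\<lambda>z. z \<noteq> x') xs)"
      unfolding del by (metis subseq_filter_left)
    then show ?thesis using assms(4) by (auto simp: contained_in_def)
  next
    case second
    \<comment> \<open>\<open>f\<close> moves the embedding from \<open>x'\<close> to the free entry
      \<open>x\<close>. It preserves order because every other entry of \<open>ys\<close> lies on
      the same side of \<open>x\<close> and \<open>x'\<close>.\<close>
    define f where "f z = (if z = x' then x else z)" for z
    have ys': "ys = filter ?P ps @ x' # filter ?P qs"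
      by (subst ys) (use second in \<open>simp add: xs\<close>)
    have sm: "strict_mono_on (set ys) f"
    proof (rule strict_mono_onI)
      fix r s assume rs: "r \<in> set ys" "s \<in> set ys" "r < s"
      have "r \<noteq> x" "s \<noteq> x" using rs second by auto
      moreover have "t = x' \<or> t \<in> set ps \<union> set qs" if "t \<in> set ys" for t
        using that by (subst (asm) ys') auto
      ultimately show "f r < f s"
        using rs adj unfolding f_def by (smt (verit) linorder_neqE_nat order_less_asym)
    qed
    have "map f (filter ?P ps) = filter ?P ps" "map f (filter ?P qs) = filter ?P qs"
      using assms(1) by (auto intro!: map_idI simp: f_def xs)
    then have "map f ys = filter ?P ps @ x # filter ?P qs"
      by (subst ys') (simp add: f_def)
    then have "subseq (map f ys) (filter (\<lambda>z. z \<noteq> x') xs)"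
      unfolding del by (simp add: list_emb_append_mono)
    moreover have "order_isomorphic (map f ys) \<tau>"
      using order_isomorphic_map[OF sm] assms(4) order_isomorphic_sym order_isomorphic_trans
      by blast
    ultimately show ?thesis by (auto simp: contained_in_def)
  qed
qed

text \<open>The two values fill \<open>{a..b}\<close>, so any other entry lies outside and compares
  equally with both.\<close>

lemma is_adjacency_adjacent_in:
  assumes "distinct \<pi>" and "is_adjacency \<pi> I"
  shows "adjacent_in \<pi> (\<pi> ! Min I) (\<pi> ! Max I)"
proof -
  from assms(2) obtain i j a b where ij: "i \<le> j" "j < length \<pi>" "I = {i..j}"
    and ab: "(!) \<pi> ` I = {a..b}" and card: "card I = 2"
    unfolding is_adjacency_def is_interval_def by blast
  have j: "j = Suc i" using card ij by auto
  have mm: "Min I = i" "Max I = Suc i"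
    using ij j by (auto intro!: Min_eqI Max_eqI)
  have I: "I = {i, Suc i}" using ij j by auto
  have val: "{\<pi> ! i, \<pi> ! Suc i} = {a..b}" using ab I by simp
  have "\<pi> ! k < \<pi> ! i \<longleftrightarrow> \<pi> ! k < \<pi> ! Suc i"
    if "k < length \<pi>" "k \<noteq> i" "k \<noteq> Suc i" for k
  proof -
    have "\<pi> ! k \<notin> {a..b}"
      using that assms(1) ij j by (auto simp: val[symmetric] nth_eq_iff_index_eq)
    moreover have "\<pi> ! i \<in> {a..b}" "\<pi> ! Suc i \<in> {a..b}"
      by (auto simp: val[symmetric])
    ultimately show ?thesis by auto
  qed
  then show ?thesis
    unfolding adjacent_in_nth mm using ij j by blast
qed

lemma adjacent_in_unique:
  assumes "distinct xs"
  shows "adjacent_in xs x x' \<Longrightarrow> adjacent_in xs x z \<Longrightarrow> z = x'"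
    and "adjacent_in xs x x' \<Longrightarrow> adjacent_in xs z x' \<Longrightarrow> z = x"
    and "adjacent_in xs x x' \<Longrightarrow> \<not> adjacent_in xs x' x"
proof -
  note index = nth_eq_iff_index_eq[OF assms, THEN iffD1]
  show "z = x'" if "adjacent_in xs x x'" "adjacent_in xs x z"
  proof -
    from that obtain i j where "Suc i < length xs" "x = xs ! i" "x' = xs ! Suc i"
      "Suc j < length xs" "x = xs ! j" "z = xs ! Suc j"
      unfolding adjacent_in_nth by blast
    then show ?thesis using index[of i j] by simp
  qed
  show "z = x" if "adjacent_in xs x x'" "adjacent_in xs z x'"
  proof -
    from that obtain i j where "Suc i < length xs" "x = xs ! i" "x' = xs ! Suc i"
      "Suc j < length xs" "z = xs ! j" "x' = xs ! Suc j"
      unfolding adjacent_in_nth by blast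
    then show ?thesis using index[of "Suc i" "Suc j"] by simp
  qed
  show "\<not> adjacent_in xs x' x" if "adjacent_in xs x x'"
  proof
    assume "adjacent_in xs x' x"
    with that obtain i j where "Suc i < length xs" "x = xs ! i" "x' = xs ! Suc i"
      "Suc j < length xs" "x' = xs ! j" "x = xs ! Suc j"
      unfolding adjacent_in_nth by blast
    then show False using index[of i "Suc j"] index[of "Suc i" j] by simp
  qed
qed

lemma adjacent_inD:
  assumes "adjacent_in xs x x'"
  shows "x \<in> set xs" "x' \<in> set xs"
    and "z \<in> set xs \<Longrightarrow> z \<noteq> x \<Longrightarrow> z \<noteq> x' \<Longrightarrow> z < x \<longleftrightarrow> z < x'"
proof -
  from assms obtain ps qs where xs: "xs = ps @ x # x' # qs"
    and adj: "\<forall>z\<in>set ps \<union> set qs. z < x \<longleftrightarrow> z < x'"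
    unfolding adjacent_in_def by blast
  show "x \<in> set xs" "x' \<in> set xs"
    by (simp_all add: xs)
  show "z < x \<longleftrightarrow> z < x'" if "z \<in> set xs" "z \<noteq> x" "z \<noteq> x'"
  proof -
    have "z \<in> set ps \<union> set qs" using that by (simp add: xs)
    then show ?thesis using adj by blast
  qed
qed

text \<open>Sharing the first or the second entry would make the pairs equal, against their
  directions. If \<open>x = y'\<close>, the common entry is the smaller one in both pairs, and
  neither of \<open>y\<close> and \<open>x'\<close> could be below the other. If
  \<open>x' = y\<close>, it is the larger one, and \<open>x\<close> and \<open>y'\<close> would each
  be below the other.\<close>

lemma opposing_adjacent_in_disjoint:
  assumes "distinct xs" "adjacent_in xs x x'" "x < x'" "adjacent_in xs y y'" "y' < y"
  shows "{x, x'} \<inter> {y, y'} = {}"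
proof -
  note x = adjacent_inD[OF assms(2)] and y = adjacent_inD[OF assms(4)]
  have "x \<noteq> y"
    using adjacent_in_unique(1)[OF assms(1,2), of y'] assms(3-5) by auto
  moreover have "x' \<noteq> y'"
    using adjacent_in_unique(2)[OF assms(1,2), of y] assms(3-5) by auto
  moreover have "x \<noteq> y'"
  proof
    assume "x = y'"
    moreover from this have "y \<noteq> x'"
      using adjacent_in_unique(3)[OF assms(1,2)] assms(4) by auto
    ultimately show False
      using x(3)[OF y(1)] y(3)[OF x(2)] assms(3,5) by auto
  qed
  moreover have "x' \<noteq> y"
  proof
    assume "x' = y"
    moreover from this have "x \<noteq> y'"
      using adjacent_in_unique(3)[OF assms(1,2)] assms(4) by auto
    ultimately show False
      using x(3)[OF y(2)] y(3)[OF x(1)] assms(3,5) by auto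
  qed
  ultimately show ?thesis by auto
qed

section \<open>The induction on length and the theorem\<close>

lemma mobius_opposing_adjacent_in:
  assumes "is_perm \<pi>" "adjacent_in \<pi> x x'" "x < x'" "adjacent_in \<pi> y y'" "y' < y"
  shows "mobius [1] \<pi> = 0"
  using assms
proof (induction "length \<pi>" arbitrary: \<pi> x x' y y' rule: less_induct)
  case less
  note adj = less.prems(2-5)
  have dist: "distinct \<pi>" using less.prems(1) by (rule is_perm_distinct)
  \<comment> \<open>The induction hypothesis for patterns: the two adjacencies may be inherited
    through different embeddings \<open>us\<close> and \<open>vs\<close> of the same
    \<open>\<tau>\<close>.\<close>
  have vanish: "mobius [1] \<tau> = 0"
    if "is_perm \<tau>" "length \<tau> < length \<pi>" "order_isomorphic us \<tau>" "adjacent_in us x x'"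
      "order_isomorphic vs \<tau>" "adjacent_in vs y y'" for \<tau> us vs
    using that less.hyps adj(2,4) adjacent_in_order_isomorphic by metis
  have disj: "{x, x'} \<inter> {y, y'} = {}"
    using opposing_adjacent_in_disjoint[OF dist adj] .
  have mem: "{x, x', y, y'} \<subseteq> set \<pi>"
    using adjacent_inD(1,2) adj by blast
  define \<alpha> where "\<alpha> = filter (\<lambda>z. z \<noteq> x') \<pi>"
  define \<beta> where "\<beta> = filter (\<lambda>z. z \<noteq> y') \<pi>"
  define \<phi> where "\<phi> = filter (\<lambda>z. z \<noteq> y') \<alpha>"
  have \<phi>': "\<phi> = filter (\<lambda>z. z \<noteq> x') \<beta>"
    by (auto simp: \<phi>_def \<alpha>_def \<beta>_def intro: filter_cong)
  have sub: "subseq \<alpha> \<pi>" "subseq \<beta> \<pi>" "subseq \<phi> \<alpha>" "subseq \<phi> \<beta>"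
    unfolding \<alpha>_def \<beta>_def using \<phi>_def[unfolded \<alpha>_def] \<phi>'[unfolded \<beta>_def]
    by (metis subseq_filter_left)+
  have d: "distinct \<alpha>" "distinct \<beta>" "distinct \<phi>"
    using dist by (auto simp: \<alpha>_def \<beta>_def \<phi>_def)
  \<comment> \<open>The entries \<open>x\<close> and \<open>y\<close> survive both deletions, so
    \<open>\<phi>\<close> is long enough for its sum to vanish.\<close>
  have "{x, y} \<subseteq> set \<phi>" "x \<noteq> y"
    using mem disj adj by (auto simp: \<phi>_def \<alpha>_def)
  then have "2 \<le> length \<phi>"
    using card_mono[of "set \<phi>" "{x, y}"] d by (simp add: distinct_card)
  moreover have "length \<phi> \<le> length \<alpha>" "length \<phi> \<le> length \<beta>"
    using sub list_emb_length by blast+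
  ultimately have sums: "sum (mobius [1]) (perm_Icc [1] \<alpha>) = 0"
    "sum (mobius [1]) (perm_Icc [1] \<beta>) = 0" "sum (mobius [1]) (perm_Icc [1] \<phi>) = 0"
    using d sum_mobius_distinct by auto
  have len: "2 \<le> length \<pi>" "length \<alpha> < length \<pi>" "length \<beta> < length \<pi>"
    using mem \<open>2 \<le> length \<phi>\<close> \<open>length \<phi> \<le> length \<alpha>\<close>
      length_filter_less[of x' \<pi>] length_filter_less[of y' \<pi>]
    by (auto simp: \<alpha>_def \<beta>_def intro: order_trans length_filter_le)
  let ?A = "perm_Icc [1] \<alpha>" and ?B = "perm_Icc [1] \<beta>"
  have "sum (mobius [1]) (?A \<inter> ?B) = sum (mobius [1]) (perm_Icc [1] \<phi>)"
  proof (rule sum.mono_neutral_right)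
    show "finite (?A \<inter> ?B)" by (simp add: finite_perm_Icc)
    show "perm_Icc [1] \<phi> \<subseteq> ?A \<inter> ?B"
      using sub contained_in_subseq by (auto simp: perm_Icc_def)
    show "\<forall>\<tau>\<in>?A \<inter> ?B - perm_Icc [1] \<phi>. mobius [1] \<tau> = 0"
    proof
      fix \<tau> assume "\<tau> \<in> ?A \<inter> ?B - perm_Icc [1] \<phi>"
      then have \<tau>: "is_perm \<tau>" "contained_in \<tau> \<alpha>" "contained_in \<tau> \<beta>" "\<not> contained_in \<tau> \<phi>"
        by (auto simp: perm_Icc_def)
      from \<tau>(2,3) obtain us vs where us: "subseq us \<beta>" "order_isomorphic us \<tau>"
        and vs: "subseq vs \<alpha>" "order_isomorphic vs \<tau>"
        by (auto simp: contained_in_def)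
      \<comment> \<open>Each deletion leaves the other adjacency intact. Deleting \<open>y'\<close>
        from \<open>\<alpha>\<close>, or \<open>x'\<close> from \<open>\<beta>\<close>, gives
        \<open>\<phi>\<close>, which avoids \<open>\<tau>\<close>; hence each embedding must use
        both entries of the remaining adjacency.\<close>
      have "adjacent_in \<alpha> y y'" "adjacent_in \<beta> x x'"
        unfolding \<alpha>_def \<beta>_def using adj disj by (auto intro!: adjacent_in_filter)
      then have "adjacent_in vs y y'" "adjacent_in us x x'"
        using subseq_adjacent_cases us vs d \<tau>(4) \<phi>_def \<phi>' by metis+
      then show "mobius [1] \<tau> = 0"
        using vanish[OF \<tau>(1)] us(2) vs(2) contained_in_length[OF \<tau>(2)] len by auto
    qed
  qed
  \<comment> \<open>Inclusion-exclusion over the two closed intervals.\<close>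
  then have union: "sum (mobius [1]) (?A \<union> ?B) = 0"
    using sum.union_inter[of ?A ?B "mobius [1]"] sums by (simp add: finite_perm_Icc)
  have "sum (mobius [1]) (perm_Ico [1] \<pi>) = sum (mobius [1]) (?A \<union> ?B)"
  proof (rule sum.mono_neutral_right)
    show "finite (perm_Ico [1] \<pi>)"
      using finite_perm_Icc by (auto simp: perm_Ico_def)
    \<comment> \<open>Patterns of \<open>\<alpha>\<close> or \<open>\<beta>\<close> are shorter than
      \<open>\<pi>\<close>, hence different from it.\<close>
    show "?A \<union> ?B \<subseteq> perm_Ico [1] \<pi>"
      using sub contained_in_subseq contained_in_length len
      by (fastforce simp: perm_Ico_def perm_Icc_def)
    show "\<forall>\<tau>\<in>perm_Ico [1] \<pi> - (?A \<union> ?B). mobius [1] \<tau> = 0"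
    proof
      fix \<tau> assume *: "\<tau> \<in> perm_Ico [1] \<pi> - (?A \<union> ?B)"
      then have \<tau>: "is_perm \<tau>" "\<not> contained_in \<tau> \<alpha>" "\<not> contained_in \<tau> \<beta>"
        by (auto simp: perm_Icc_def perm_Ico_def)
      from * obtain us where us: "subseq us \<pi>" "order_isomorphic us \<tau>"
        by (auto simp: contained_in_def perm_Icc_def perm_Ico_def)
      \<comment> \<open>Here a single embedding into \<open>\<pi>\<close> inherits both
        adjacencies.\<close>
      have "adjacent_in us x x'" "adjacent_in us y y'"
        using subseq_adjacent_cases[OF dist _ us] adj \<tau> unfolding \<alpha>_def \<beta>_def by blast+
      then show "mobius [1] \<tau> = 0"
        using vanish[OF \<tau>(1) _ us(2) _ us(2)] perm_Ico_length_less[OF less.prems(1)] * by blast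
    qed
  qed
  then show ?case
    using union mobius.simps[of "[1]" \<pi>] len by auto
qed

theorem theorem3p1:
  fixes \<pi> :: "nat list"
  assumes "is_perm \<pi>"
    and "has_opposing_adjacencies \<pi>"
  shows "mobius [1] \<pi> = 0"
proof -
  from assms(2) obtain I J where I: "is_adjacency \<pi> I" "\<pi> ! Min I < \<pi> ! Max I"
    and J: "is_adjacency \<pi> J" "\<not> \<pi> ! Min J < \<pi> ! Max J"
    by (auto simp: has_opposing_adjacencies_def is_down_adjacency_def is_up_adjacency_def)
  note dist = is_perm_distinct[OF assms(1)]
  note adj = is_adjacency_adjacent_in[OF dist I(1)] is_adjacency_adjacent_in[OF dist J(1)]
  \<comment> \<open>Equal values would give an adjacency that is its own reversal. So not being an
    up-adjacency yields a strict descent.\<close>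
  have "\<pi> ! Min J \<noteq> \<pi> ! Max J"
    using adjacent_in_unique(3)[OF dist adj(2)] adj(2) by metis
  then show ?thesis
    using mobius_opposing_adjacent_in[OF assms(1) adj(1) I(2) adj(2)] J(2) by simp
qed

end
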